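(* For $\Sigma\in\operatorname{Sym}^{++}(n)$ and $U,V\in\operatorname{Sym}(n)$ put $$\langle U,V\rangle_\Sigma \equiv W_\Sigma(U,V)=\operatorname{Tr}\left(\mathcal L_\Sigma[U]\,\Sigma\,\mathcal L_\Sigma[V]\right).$$ Then $W$ defines a (Riemannian) metric on $\operatorname{Sym}^{++}(n)$ such that the mapping $\sigma\colon \operatorname{GL}(n)\to\operatorname{Sym}^{++}(n)$, $\sigma(A)=AA^*$, is a Riemannian submersion.
   Context: All matrices are real and $A^*$ denotes the transpose. $\operatorname{M}(n)$ is the space of $n\times n$ matrices with the Frobenius inner product $\langle A,B\rangle=\operatorname{Tr}(AB^* )$; $\operatorname{GL}(n)\subset \operatorname{M}(n)$ is the open set of invertible matrices (with the flat metric given by the Frobenius inner product). $\operatorname{Sym}(n)$ is the space of symmetric matrices and $\operatorname{Sym}^{++}(n)$ the open cone of positive-definite ones, whose tangent space at each point is identified with $\operatorname{Sym}(n)$. For $\Sigma\in\operatorname{Sym}^{++}(n)$ and $V\in\operatorname{Sym}(n)$, $\mathcal L_\Sigma[V]$ denotes the unique $X\in\operatorname{Sym}(n)$ solving the Lyapunov equation $X\Sigma+\Sigma X=V$. The derivative of $\sigma$ is $d\sigma(A)[X]=XA^*+AX^*$. The space of horizontal vectors at $A$ is $\mathcal H_A=\operatorname{Ker}(d\sigma(A))^\perp$ (orthogonal complement in $\operatorname{M}(n)$ for the Frobenius inner product), which equals $\operatorname{Sym}(n)A$. The submersion $\sigma$ is called Riemannian if, for every $A\in\operatorname{GL}(n)$,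 the restriction of $d\sigma(A)$ to $\mathcal H_A$ is an isometry onto the tangent space at $\sigma(A)$, i.e. $\langle d\sigma(A)[U],d\sigma(A)[V]\rangle_{\sigma(A)}=\langle U,V\rangle$ for all $U,V\in\mathcal H_A$. *)

theory Defs
  imports "HOL-Analysis.Analysis"
begin

section \<open>Smooth maps, Riemannian metrics and Riemannian submersions\<close>

text \<open>
  Manifolds here are relatively open subsets \<open>M\<close> of a linear subspace \<open>T\<close> of a Euclidean space, and
  every tangent space of \<open>M\<close> is identified with \<open>T\<close>. The derivative along \<open>M\<close> is unique on \<open>T\<close> only,
  so a map is \<open>C\<^sup>k\<^sup>+\<^sup>1\<close> if it is Frechet differentiable along \<open>M\<close> and its directional derivatives in
  the directions of \<open>T\<close> are \<open>C\<^sup>k\<close>. As \<open>T\<close> is finite-dimensional, this is the usual notion.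
\<close>

primrec Ck_on :: "nat \<Rightarrow> 'a::euclidean_space set \<Rightarrow> 'a set \<Rightarrow> ('a \<Rightarrow> 'b::real_normed_vector) \<Rightarrow> bool" where
  "Ck_on 0 T M f \<longleftrightarrow> continuous_on M f"
| "Ck_on (Suc k) T M f \<longleftrightarrow>
     (\<exists>f'. (\<forall>x\<in>M. (f has_derivative f' x) (at x within M)) \<and>
           (\<forall>v\<in>T. Ck_on k T M (\<lambda>x. f' x v)))"

definition smooth_on :: "'a::euclidean_space set \<Rightarrow> 'a set \<Rightarrow> ('a \<Rightarrow> 'b::real_normed_vector) \<Rightarrow> bool" where
  "smooth_on T M f \<longleftrightarrow> (\<forall>k. Ck_on k T M f)"

definition inner_product_on :: "'a::real_vector set \<Rightarrow> ('a \<Rightarrow> 'a \<Rightarrow> real) \<Rightarrow> bool" where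
  "inner_product_on T g \<longleftrightarrow>
     (\<forall>u\<in>T. \<forall>v\<in>T. \<forall>w\<in>T. g (u + v) w = g u w + g v w) \<and>
     (\<forall>u\<in>T. \<forall>v\<in>T. \<forall>c. g (c *\<^sub>R u) v = c * g u v) \<and>
     (\<forall>u\<in>T. \<forall>v\<in>T. g u v = g v u) \<and>
     (\<forall>u\<in>T. u \<noteq> 0 \<longrightarrow> g u u > 0)"

definition riemannian_metric_on ::
    "'a::euclidean_space set \<Rightarrow> 'a set \<Rightarrow> ('a \<Rightarrow> 'a \<Rightarrow> 'a \<Rightarrow> real) \<Rightarrow> bool" where
  "riemannian_metric_on T M g \<longleftrightarrow>
     subspace T \<and> openin (top_of_set T) M \<and>
     (\<forall>x\<in>M. inner_product_on T (g x)) \<and>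
     (\<forall>u\<in>T. \<forall>v\<in>T. smooth_on T M (\<lambda>x. g x u v))"

definition horizontal_space ::
    "('a::real_normed_vector \<Rightarrow> 'a \<Rightarrow> 'a \<Rightarrow> real) \<Rightarrow> ('a \<Rightarrow> 'b::real_normed_vector) \<Rightarrow> 'a \<Rightarrow> 'a set" where
  "horizontal_space g f x = {u. \<forall>w. frechet_derivative f (at x) w = 0 \<longrightarrow> g x u w = 0}"

text \<open>
  The source \<open>M\<close> is open in the whole space, so its tangent spaces are \<^term>\<open>UNIV\<close> and the derivative
  of \<open>f\<close> at a point of \<open>M\<close> is the ordinary Frechet derivative; the target \<open>N\<close> is open in the
  subspace \<open>T\<close>.
\<close>

definition riemannian_submersion ::
    "'a::euclidean_space set \<Rightarrow> ('a \<Rightarrow> 'a \<Rightarrow> 'a \<Rightarrow> real) \<Rightarrow>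
     'b::euclidean_space set \<Rightarrow> 'b set \<Rightarrow> ('b \<Rightarrow> 'b \<Rightarrow> 'b \<Rightarrow> real) \<Rightarrow> ('a \<Rightarrow> 'b) \<Rightarrow> bool" where
  "riemannian_submersion M g T N h f \<longleftrightarrow>
     riemannian_metric_on UNIV M g \<and> riemannian_metric_on T N h \<and>
     f ` M \<subseteq> N \<and> smooth_on UNIV M f \<and>
     (\<forall>x\<in>M. range (frechet_derivative f (at x)) = T \<and>
        bij_betw (frechet_derivative f (at x)) (horizontal_space g f x) T \<and>
        (\<forall>u\<in>horizontal_space g f x. \<forall>v\<in>horizontal_space g f x.
           h (f x) (frechet_derivative f (at x) u) (frechet_derivative f (at x) v) = g x u v))"


section \<open>Matrices\<close>

definition GL :: "(real^'n^'n) set" where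
  "GL = {A. invertible A}"

definition Sym :: "(real^'n^'n) set" where
  "Sym = {A. transpose A = A}"

definition SymPD :: "(real^'n^'n) set" where
  "SymPD = {A \<in> Sym. \<forall>x. x \<noteq> 0 \<longrightarrow> x \<bullet> (A *v x) > 0}"

definition frobenius :: "real^'n^'n \<Rightarrow> real^'n^'n \<Rightarrow> real" where
  "frobenius A B = trace (A ** transpose B)"

definition lyapunov :: "real^'n^'n \<Rightarrow> real^'n^'n \<Rightarrow> real^'n^'n" where
  "lyapunov \<Sigma> V = (THE X. X \<in> Sym \<and> X ** \<Sigma> + \<Sigma> ** X = V)"

definition W_metric :: "real^'n^'n \<Rightarrow> real^'n^'n \<Rightarrow> real^'n^'n \<Rightarrow> real" where
  "W_metric \<Sigma> U V = trace (lyapunov \<Sigma> U ** \<Sigma> ** lyapunov \<Sigma> V)"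

definition sigma_map :: "real^'n^'n \<Rightarrow> real^'n^'n" where
  "sigma_map A = A ** transpose A"

end

theory Submission
  imports Defs
begin

text \<open>
  The Frobenius form is the Euclidean inner product of \<^typ>\<open>real^'n^'n\<close>, so the whole argument
  can be run with adjoints: left and right multiplication by \<open>A\<close> have adjoints left and right
  multiplication by \<open>A\<^sup>T\<close>.

  If \<open>\<Sigma>\<close> is positive definite, the operator \<open>S\<^sub>\<Sigma> X = X \<Sigma> + \<Sigma> X\<close> satisfies
  \<open>\<langle>S\<^sub>\<Sigma> X, X\<rangle> > 0\<close> for every nonzero \<open>X\<close>, symmetric or not. Hence it is bijective on all matrices, and
  as it commutes with transposition, its inverse preserves symmetry; this gives the Lyapunov
  operator \<open>L\<^sub>\<Sigma>\<close> as an honest inverse. Since \<open>S\<^sub>\<Sigma>\<close> is self-adjoint,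
  \<open>W\<^sub>\<Sigma>(U, V) = \<langle>U, L\<^sub>\<Sigma> V\<rangle> / 2\<close>, which is therefore symmetric, bilinear and positive definite in
  \<open>(U, V)\<close>.

  Smoothness in \<open>\<Sigma>\<close> comes from differentiating the equation \<open>S\<^sub>\<Sigma> (L\<^sub>\<Sigma> g) = g\<close>: the derivative of
  \<open>h = L\<^sub>\<Sigma> g(\<Sigma>)\<close> in the direction \<open>v\<close> is \<open>L\<^sub>\<Sigma>\<close> applied to \<open>g' v - (h v + v h)\<close>, an expression of
  the same shape with one derivative less on \<open>g\<close> and \<open>h\<close>, so induction on the order works
  (lemma \<open>Ck_on_linear_solution\<close>).

  For the submersion, let \<open>\<Sigma> = A A\<^sup>T\<close> and let \<open>D\<close> be the derivative of \<open>\<sigma>\<close> at \<open>A\<close>. Then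
  \<open>D (X A) = S\<^sub>\<Sigma> X\<close> for symmetric \<open>X\<close>, so \<open>V \<mapsto> L\<^sub>\<Sigma>[V] A\<close> is a right inverse of \<open>D\<close> on symmetric
  matrices. Its values are orthogonal to the kernel of \<open>D\<close>, and \<open>D\<close> is injective on the orthogonal
  complement of its kernel; so every horizontal vector is \<open>X A\<close> with \<open>X\<close> symmetric, and the isometry
  property is the identity \<open>Tr(X A A\<^sup>T Y) = \<langle>X A, Y A\<rangle>\<close>.
\<close>

section \<open>Calculus of \<open>C\<^sup>k\<close> maps\<close>

lemma Ck_on_const: "Ck_on k T M (\<lambda>_. c)"
proof (induction k arbitrary: c)
  case (Suc k)
  have "\<forall>x\<in>M. ((\<lambda>_. c) has_derivative (\<lambda>_. 0)) (at x within M)"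
    by simp
  then show ?case
    using Suc by (auto intro!: exI[of _ "\<lambda>_ _. 0"])
qed simp

lemma Ck_on_cong:
  assumes "Ck_on k T M f" and eq: "\<And>x. x \<in> M \<Longrightarrow> f x = g x"
  shows "Ck_on k T M g"
proof (cases k)
  case 0
  then show ?thesis
    using assms continuous_on_cong[of M M f g] by simp
next
  case (Suc j)
  then obtain f' where "\<forall>x\<in>M. (f has_derivative f' x) (at x within M)"
    and "\<forall>v\<in>T. Ck_on j T M (\<lambda>x. f' x v)"
    using assms(1) by auto
  moreover from this have "\<forall>x\<in>M. (g has_derivative f' x) (at x within M)"
    using eq by (metis has_derivative_transform)
  ultimately show ?thesis
    using Suc by auto
qed

lemma Ck_on_Suc_imp_Ck_on: "Ck_on (Suc k) T M f \<Longrightarrow> Ck_on k T M f"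
proof (induction k arbitrary: f)
  case 0
  then show ?case
    by (auto intro: has_derivative_continuous_on)
next
  case (Suc k)
  then obtain f' where f': "\<forall>x\<in>M. (f has_derivative f' x) (at x within M)"
    and "\<forall>v\<in>T. Ck_on (Suc k) T M (\<lambda>x. f' x v)"
    by (metis Ck_on.simps(2))
  then have "\<forall>v\<in>T. Ck_on k T M (\<lambda>x. f' x v)"
    using Suc.IH by blast
  with f' show ?case
    by auto
qed

lemma Ck_on_diff:
  assumes "Ck_on k T M f" "Ck_on k T M g"
  shows "Ck_on k T M (\<lambda>x. f x - g x)"
  using assms
proof (induction k arbitrary: f g)
  case 0
  then show ?case
    by (auto intro: continuous_on_diff)
next
  case (Suc k)
  then obtain f' g' where "\<forall>x\<in>M. (f has_derivative f' x) (at x within M)"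
    and f': "\<forall>v\<in>T. Ck_on k T M (\<lambda>x. f' x v)"
    and "\<forall>x\<in>M. (g has_derivative g' x) (at x within M)"
    and g': "\<forall>v\<in>T. Ck_on k T M (\<lambda>x. g' x v)"
    by auto
  then have "\<forall>x\<in>M. ((\<lambda>x. f x - g x) has_derivative (\<lambda>v. f' x v - g' x v)) (at x within M)"
    by (auto intro: has_derivative_diff)
  moreover have "\<forall>v\<in>T. Ck_on k T M (\<lambda>x. f' x v - g' x v)"
    using f' g' Suc.IH by blast
  ultimately show ?case
    by (auto intro!: exI[of _ "\<lambda>x v. f' x v - g' x v"])
qed

lemma Ck_on_bounded_linear_compose:
  assumes "bounded_linear l" "Ck_on k T M f"
  shows "Ck_on k T M (\<lambda>x. l (f x))"
  using assms(2)
proof (induction k arbitrary: f)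
  case 0
  then show ?case
    using assms(1) by (auto intro: bounded_linear.continuous_on)
next
  case (Suc k)
  then obtain f' where "\<forall>x\<in>M. (f has_derivative f' x) (at x within M)"
    and f': "\<forall>v\<in>T. Ck_on k T M (\<lambda>x. f' x v)"
    by auto
  then have "\<forall>x\<in>M. ((\<lambda>x. l (f x)) has_derivative (\<lambda>v. l (f' x v))) (at x within M)"
    using assms(1) by (auto intro: bounded_linear.has_derivative)
  moreover have "\<forall>v\<in>T. Ck_on k T M (\<lambda>x. l (f' x v))"
    using f' Suc.IH by blast
  ultimately show ?case
    by (auto intro!: exI[of _ "\<lambda>x v. l (f' x v)"])
qed

lemma Ck_on_bounded_linear:
  assumes "bounded_linear l"
  shows "Ck_on k T M l"
proof (cases k)
  case 0
  then show ?thesis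
    using assms by (simp add: linear_continuous_on)
next
  case (Suc j)
  have "\<forall>x\<in>M. (l has_derivative l) (at x within M)"
    using assms by (simp add: bounded_linear_imp_has_derivative)
  then show ?thesis
    using Suc by (auto intro!: exI[of _ "\<lambda>_. l"] Ck_on_const)
qed

section \<open>Solutions of linear equations depending on a parameter\<close>

text \<open>
  The estimate comes from
  \<open>h y - h x = L\<^sub>x (g y - g x - B (y - x) (h y))\<close>, whose last term is split at \<open>h x\<close>: near \<open>x\<close> the part
  with \<open>h y - h x\<close> has a small coefficient and is absorbed into the left-hand side, so no a priori
  bound on \<open>h\<close> is required.
\<close>

lemma continuous_on_linear_solution:
  fixes B :: "'a::real_normed_vector \<Rightarrow> 'b::real_normed_vector \<Rightarrow> 'c::real_normed_vector"
  assumes B: "bounded_bilinear B"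
    and L: "\<And>x. x \<in> M \<Longrightarrow> bounded_linear (L x)"
    and BL: "\<And>x w. x \<in> M \<Longrightarrow> B x (L x w) = w"
    and LB: "\<And>x u. x \<in> M \<Longrightarrow> L x (B x u) = u"
    and g: "continuous_on M g"
  shows "continuous_on M (\<lambda>x. L x (g x))"
  unfolding continuous_on_def
proof
  fix x assume x: "x \<in> M"
  interpret B: bounded_bilinear B by (fact B)
  interpret Lx: bounded_linear "L x" using L[OF x] .
  define h where "h y = L y (g y)" for y
  obtain C where C: "C > 0" "\<And>a b. norm (B a b) \<le> norm a * norm b * C"
    using B.pos_bounded by blast
  obtain K where K: "K > 0" "\<And>w. norm (L x w) \<le> norm w * K"
    using Lx.pos_bounded by blast
  define e where "e y = 2 * K * (norm (g y - g x) + norm (y - x) * norm (h x) * C)" for y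
  have bound: "norm (h y - h x) \<le> e y" if y: "y \<in> M" and small: "norm (y - x) * C * K \<le> 1/2" for y
  proof -
    have "B x (h y - h x) = B y (h y) - B (y - x) (h y) - B x (h x)"
      by (simp add: B.diff_left B.diff_right)
    also have "\<dots> = (g y - g x) - B (y - x) (h y - h x) - B (y - x) (h x)"
      using BL[OF x] BL[OF y] by (simp add: h_def B.diff_right)
    finally have "h y - h x = L x ((g y - g x) - B (y - x) (h y - h x) - B (y - x) (h x))"
      using LB[OF x] by metis
    then have "norm (h y - h x) \<le>
        norm ((g y - g x) - B (y - x) (h y - h x) - B (y - x) (h x)) * K"
      using K(2) by metis
    also have "\<dots> \<le> (norm (g y - g x) + norm (y - x) * norm (h y - h x) * C
        + norm (y - x) * norm (h x) * C) * K"
      using K(1) C(2)[of "y - x" "h y - h x"] C(2)[of "y - x" "h x"]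
        norm_triangle_ineq4[of "(g y - g x) - B (y - x) (h y - h x)" "B (y - x) (h x)"]
        norm_triangle_ineq4[of "g y - g x" "B (y - x) (h y - h x)"]
      by (intro mult_right_mono) linarith+
    also have "\<dots> = (norm (g y - g x) + norm (y - x) * norm (h x) * C) * K
        + norm (y - x) * C * K * norm (h y - h x)"
      by (simp add: algebra_simps)
    also have "\<dots> \<le> (norm (g y - g x) + norm (y - x) * norm (h x) * C) * K
        + 1/2 * norm (h y - h x)"
      using small by (intro add_left_mono mult_right_mono) auto
    finally show ?thesis
      by (simp add: e_def algebra_simps)
  qed
  have lim_diff: "((\<lambda>y. norm (y - x)) \<longlongrightarrow> 0) (at x within M)"
    by (intro tendsto_norm_zero LIM_zero tendsto_ident_at)
  have lim_g: "((\<lambda>y. norm (g y - g x)) \<longlongrightarrow> 0) (at x within M)"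
    using g x by (simp add: continuous_on_def tendsto_norm_zero_iff LIM_zero_iff)
  have "((\<lambda>y. norm (y - x) * C * K) \<longlongrightarrow> 0) (at x within M)"
    by (intro tendsto_mult_left_zero lim_diff)
  then have "\<forall>\<^sub>F y in at x within M. norm (y - x) * C * K < 1/2"
    by (rule order_tendstoD) simp
  then have "\<forall>\<^sub>F y in at x within M. norm (h y - h x) \<le> e y"
    unfolding eventually_at_filter by eventually_elim (auto intro: bound)
  moreover have "(e \<longlongrightarrow> 0) (at x within M)"
    unfolding e_def
    by (intro tendsto_mult_right_zero tendsto_add_zero tendsto_mult_left_zero lim_diff lim_g)
  ultimately have "((\<lambda>y. h y - h x) \<longlongrightarrow> 0) (at x within M)"
    by (rule Lim_null_comparison)
  then show "((\<lambda>y. L y (g y)) \<longlongrightarrow> L x (g x)) (at x within M)"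
    by (simp add: h_def LIM_zero_iff)
qed

text \<open>
  Differentiating \<open>B x (h x) = g x\<close> formally gives \<open>B x (h' v) = g' v - B v (h x)\<close>. In the remainder
  the only term that is not already controlled by \<open>g\<close> is \<open>L\<^sub>x (B (y - x) (h y - h x))\<close>, which is
  \<open>o(norm (y - x))\<close> because \<open>h\<close> is continuous.
\<close>

lemma has_derivative_linear_solution:
  fixes B :: "'a::real_normed_vector \<Rightarrow> 'b::real_normed_vector \<Rightarrow> 'c::real_normed_vector"
  assumes B: "bounded_bilinear B"
    and L: "\<And>x. x \<in> M \<Longrightarrow> bounded_linear (L x)"
    and BL: "\<And>x w. x \<in> M \<Longrightarrow> B x (L x w) = w"
    and LB: "\<And>x u. x \<in> M \<Longrightarrow> L x (B x u) = u"
    and cont_g: "continuous_on M g"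
    and g': "(g has_derivative g') (at x within M)"
    and x: "x \<in> M"
  shows "((\<lambda>x. L x (g x)) has_derivative (\<lambda>v. L x (g' v - B v (L x (g x))))) (at x within M)"
proof -
  interpret B: bounded_bilinear B by (fact B)
  interpret Lx: bounded_linear "L x" using L[OF x] .
  define h where "h y = L y (g y)" for y
  obtain C where C: "C > 0" "\<And>a b. norm (B a b) \<le> norm a * norm b * C"
    using B.pos_bounded by blast
  obtain K where K: "K > 0" "\<And>w. norm (L x w) \<le> norm w * K"
    using Lx.pos_bounded by blast
  have "continuous_on M h"
    unfolding h_def using continuous_on_linear_solution[OF B L BL LB cont_g] .
  then have lim_h: "((\<lambda>y. norm (h y - h x)) \<longlongrightarrow> 0) (at x within M)"
    using x by (simp add: continuous_on_def tendsto_norm_zero_iff LIM_zero_iff)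
  have lin_g': "bounded_linear g'"
    and lim_g: "((\<lambda>y. norm ((g y - g x) - g' (y - x)) / norm (y - x)) \<longlongrightarrow> 0) (at x within M)"
    using g' by (auto simp: has_derivative_iff_norm)
  define e where
    "e y = (norm ((g y - g x) - g' (y - x)) / norm (y - x) + norm (h y - h x) * C) * K" for y
  have "norm (norm ((h y - h x) - L x (g' (y - x) - B (y - x) (h x))) / norm (y - x)) \<le> e y"
    if y: "y \<in> M" and ne: "y \<noteq> x" for y
  proof -
    have "B x (h y - h x) = B y (h y) - B (y - x) (h y) - B x (h x)"
      by (simp add: B.diff_left B.diff_right)
    also have "\<dots> = (g y - g x) - B (y - x) (h y - h x) - B (y - x) (h x)"
      using BL[OF x] BL[OF y] by (simp add: h_def B.diff_right)
    finally have hyx: "h y - h x = L x ((g y - g x) - B (y - x) (h y - h x) - B (y - x) (h x))"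
      using LB[OF x] by metis
    have "(h y - h x) - L x (g' (y - x) - B (y - x) (h x)) =
        L x (((g y - g x) - g' (y - x)) - B (y - x) (h y - h x))"
      by (subst hyx) (simp add: Lx.diff)
    then have "norm ((h y - h x) - L x (g' (y - x) - B (y - x) (h x))) \<le>
        norm (((g y - g x) - g' (y - x)) - B (y - x) (h y - h x)) * K"
      using K(2) by metis
    also have "\<dots> \<le> (norm ((g y - g x) - g' (y - x)) + norm (y - x) * norm (h y - h x) * C) * K"
      using K(1) C(2)[of "y - x" "h y - h x"]
        norm_triangle_ineq4[of "(g y - g x) - g' (y - x)" "B (y - x) (h y - h x)"]
      by (intro mult_right_mono) linarith+
    also have "\<dots> = e y * norm (y - x)"
      using ne by (simp add: e_def field_simps)
    finally show ?thesis
      using ne by (simp add: field_simps)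
  qed
  then have "\<forall>\<^sub>F y in at x within M.
      norm (norm ((h y - h x) - L x (g' (y - x) - B (y - x) (h x))) / norm (y - x)) \<le> e y"
    by (auto simp: eventually_at_filter)
  moreover have "(e \<longlongrightarrow> 0) (at x within M)"
    unfolding e_def by (intro tendsto_mult_left_zero tendsto_add_zero lim_g lim_h)
  ultimately have
    "((\<lambda>y. norm ((h y - h x) - L x (g' (y - x) - B (y - x) (h x))) / norm (y - x)) \<longlongrightarrow> 0)
      (at x within M)"
    by (rule Lim_null_comparison)
  moreover have "bounded_linear (\<lambda>v. L x (g' v - B v (h x)))"
    by (intro bounded_linear_compose[OF Lx.bounded_linear_axioms] bounded_linear_sub lin_g'
        B.bounded_linear_left)
  ultimately show ?thesis
    by (simp add: has_derivative_iff_norm h_def)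
qed

text \<open>
  The induction is over all right-hand sides \<open>g\<close> at once, because the derivative of the solution is
  itself the solution for another right-hand side, which involves the solution for \<open>g\<close> only to
  order \<open>k\<close>.
\<close>

lemma Ck_on_linear_solution:
  fixes B :: "'a::euclidean_space \<Rightarrow> 'b::real_normed_vector \<Rightarrow> 'c::real_normed_vector"
  assumes B: "bounded_bilinear B"
    and L: "\<And>x. x \<in> M \<Longrightarrow> bounded_linear (L x)"
    and BL: "\<And>x w. x \<in> M \<Longrightarrow> B x (L x w) = w"
    and LB: "\<And>x u. x \<in> M \<Longrightarrow> L x (B x u) = u"
    and g: "Ck_on k T M g"
  shows "Ck_on k T M (\<lambda>x. L x (g x))"
  using g
proof (induction k arbitrary: g)
  case 0
  then show ?case
    using continuous_on_linear_solution[OF B L BL LB] by simp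
next
  case (Suc k)
  then obtain g' where g': "\<forall>x\<in>M. (g has_derivative g' x) (at x within M)"
    and Ck_g': "\<forall>v\<in>T. Ck_on k T M (\<lambda>x. g' x v)"
    by auto
  have cont: "continuous_on M g"
    using g' by (auto intro: has_derivative_continuous_on)
  define h' where "h' x v = L x (g' x v - B v (L x (g x)))" for x v
  have "\<forall>x\<in>M. ((\<lambda>x. L x (g x)) has_derivative h' x) (at x within M)"
    unfolding h'_def using has_derivative_linear_solution[OF B L BL LB cont] g' by blast
  moreover have "Ck_on k T M (\<lambda>x. h' x v)" if "v \<in> T" for v
  proof -
    have "Ck_on k T M (\<lambda>x. L x (g x))"
      using Suc.IH Ck_on_Suc_imp_Ck_on[OF Suc.prems] by blast
    then have "Ck_on k T M (\<lambda>x. B v (L x (g x)))"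
      by (rule Ck_on_bounded_linear_compose[OF bounded_bilinear.bounded_linear_right[OF B]])
    then have "Ck_on k T M (\<lambda>x. g' x v - B v (L x (g x)))"
      using Ck_g' that by (intro Ck_on_diff) auto
    then show ?thesis
      unfolding h'_def by (rule Suc.IH)
  qed
  ultimately show ?case
    by auto
qed

section \<open>The Frobenius inner product\<close>

lemma frobenius_eq_inner: "frobenius A B = A \<bullet> B"
  by (simp add: frobenius_def trace_def matrix_matrix_mult_def transpose_def inner_vec_def)

lemma trace_mult_eq_inner: "trace (A ** B) = A \<bullet> transpose B" for A B :: "real^'n^'n"
  by (simp add: frobenius_eq_inner[symmetric] frobenius_def)

lemma inner_transpose: "transpose A \<bullet> transpose B = A \<bullet> B" for A :: "real^'n^'m"
  unfolding inner_vec_def transpose_def by (simp, rule sum.swap)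

lemma inner_matrix_mult_right: "(A ** B) \<bullet> C = A \<bullet> (C ** transpose B)"
  for A B C :: "real^'n^'n"
  by (simp add: frobenius_eq_inner[symmetric] frobenius_def matrix_transpose_mul matrix_mul_assoc)

lemma linear_transpose: "linear (transpose :: real^'n^'n \<Rightarrow> real^'n^'n)"
  by (rule linearI) (simp_all add: transpose_def vec_eq_iff)

lemma transpose_add: "transpose (A + B) = transpose A + transpose B" for A :: "real^'n^'n"
  by (rule linear_add[OF linear_transpose])

lemma bounded_bilinear_matrix_mult:
  "bounded_bilinear ((**) :: real^'n^'n \<Rightarrow> real^'n^'n \<Rightarrow> real^'n^'n)"
  unfolding bilinear_conv_bounded_bilinear[symmetric] bilinear_def
  by (auto intro!: linearI simp: vec_eq_iff matrix_matrix_mult_def sum.distrib sum_distrib_left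
      algebra_simps)

interpretation matrix_mult:
  bounded_bilinear "(**) :: real^'n^'n \<Rightarrow> real^'n^'n \<Rightarrow> real^'n^'n"
  by (rule bounded_bilinear_matrix_mult)

lemma subspace_Sym: "subspace (Sym :: (real^'n^'n) set)"
  by (auto simp: subspace_def Sym_def transpose_add transpose_scalar linear_0[OF linear_transpose])

section \<open>The Lyapunov operator\<close>

definition lyapunov_operator :: "real^'n^'n \<Rightarrow> real^'n^'n \<Rightarrow> real^'n^'n" where
  "lyapunov_operator \<Sigma> X = X ** \<Sigma> + \<Sigma> ** X"

lemma bounded_bilinear_lyapunov_operator: "bounded_bilinear lyapunov_operator"
  unfolding bilinear_conv_bounded_bilinear[symmetric] bilinear_def lyapunov_operator_def
  by (auto intro!: linearI simp: matrix_mult.add_left matrix_mult.add_right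
      matrix_mult.scaleR_left matrix_mult.scaleR_right scaleR_right_distrib)

lemma linear_lyapunov_operator: "linear (lyapunov_operator \<Sigma>)"
  using bounded_bilinear.bounded_linear_right[OF bounded_bilinear_lyapunov_operator]
  by (rule bounded_linear.linear)

lemma transpose_lyapunov_operator:
  "\<Sigma> \<in> Sym \<Longrightarrow> transpose (lyapunov_operator \<Sigma> X) = lyapunov_operator \<Sigma> (transpose X)"
  by (simp add: lyapunov_operator_def Sym_def transpose_add matrix_transpose_mul)

text \<open>\<open>\<langle>X, \<Sigma> X\<rangle>\<close> is the sum of the quadratic form of \<open>\<Sigma>\<close> over the columns of \<open>X\<close>.\<close>

lemma inner_SymPD_mult_pos:
  assumes "\<Sigma> \<in> SymPD" "X \<noteq> 0"
  shows "X \<bullet> (\<Sigma> ** X) > 0"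
proof -
  have pos: "x \<bullet> (\<Sigma> *v x) > 0" if "x \<noteq> 0" for x
    using assms(1) that by (simp add: SymPD_def)
  then have nonneg: "x \<bullet> (\<Sigma> *v x) \<ge> 0" for x
    by (cases "x = 0") (auto intro: less_imp_le)
  have column: "transpose (\<Sigma> ** X) $ j = \<Sigma> *v (transpose X $ j)" for j
    by (simp add: matrix_matrix_mult_def matrix_vector_mult_def transpose_def vec_eq_iff)
  have "X \<bullet> (\<Sigma> ** X) = transpose X \<bullet> transpose (\<Sigma> ** X)"
    by (simp only: inner_transpose)
  also have "\<dots> = (\<Sum>j\<in>UNIV. transpose X $ j \<bullet> (\<Sigma> *v (transpose X $ j)))"
    by (subst inner_vec_def) (simp only: column)
  finally have sum_eq: "X \<bullet> (\<Sigma> ** X) = (\<Sum>j\<in>UNIV. transpose X $ j \<bullet> (\<Sigma> *v (transpose X $ j)))" .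
  obtain j where "transpose X $ j \<noteq> 0"
    using assms(2) by (auto simp: vec_eq_iff transpose_def)
  then show ?thesis
    unfolding sum_eq by (intro sum_pos2[of UNIV j]) (auto simp: pos nonneg)
qed

lemma inner_lyapunov_operator_pos:
  assumes "\<Sigma> \<in> SymPD" "X \<noteq> 0"
  shows "X \<bullet> lyapunov_operator \<Sigma> X > 0"
proof -
  have sym: "transpose \<Sigma> = \<Sigma>"
    using assms(1) by (simp add: SymPD_def Sym_def)
  have "X \<bullet> (X ** \<Sigma>) = transpose X \<bullet> (\<Sigma> ** transpose X)"
    by (metis inner_transpose matrix_transpose_mul sym)
  moreover have "transpose X \<noteq> 0"
    using assms(2) by (metis transpose_transpose linear_0 linear_transpose)
  ultimately show ?thesis
    using inner_SymPD_mult_pos[OF assms] inner_SymPD_mult_pos[OF assms(1), of "transpose X"]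
    by (simp add: lyapunov_operator_def inner_add_right)
qed

lemma bij_lyapunov_operator:
  assumes "\<Sigma> \<in> SymPD"
  shows "bij (lyapunov_operator \<Sigma>)"
proof -
  have "inj (lyapunov_operator \<Sigma>)"
    unfolding linear_injective_0[OF linear_lyapunov_operator]
    using inner_lyapunov_operator_pos[OF assms] by (metis inner_zero_right less_irrefl)
  then show ?thesis
    using linear_injective_imp_surjective[OF linear_lyapunov_operator] by (simp add: bij_def)
qed

lemma lyapunov_unique:
  assumes "\<Sigma> \<in> SymPD" "X \<in> Sym"
  shows "lyapunov \<Sigma> (lyapunov_operator \<Sigma> X) = X"
  unfolding lyapunov_def lyapunov_operator_def[symmetric]
  using assms injD[OF bij_is_inj[OF bij_lyapunov_operator[OF assms(1)]]]
  by (intro the_equality) auto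

text \<open>
  The solution for a symmetric right-hand side is symmetric because its transpose solves the same
  equation.
\<close>

lemma lyapunov_eq_inv:
  assumes "\<Sigma> \<in> SymPD" "V \<in> Sym"
  shows "lyapunov \<Sigma> V = inv (lyapunov_operator \<Sigma>) V" and "lyapunov \<Sigma> V \<in> Sym"
proof -
  define X where "X = inv (lyapunov_operator \<Sigma>) V"
  note bij = bij_lyapunov_operator[OF assms(1)]
  have SX: "lyapunov_operator \<Sigma> X = V"
    unfolding X_def using bij by (simp add: bij_is_surj surj_f_inv_f)
  have "lyapunov_operator \<Sigma> (transpose X) = transpose V"
    using assms(1) SX by (metis (no_types, lifting) SymPD_def mem_Collect_eq transpose_lyapunov_operator)
  then have "lyapunov_operator \<Sigma> (transpose X) = lyapunov_operator \<Sigma> X"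
    using SX assms(2) by (simp add: Sym_def)
  then have "X \<in> Sym"
    using bij by (auto simp: Sym_def bij_def dest: injD)
  moreover from this have "lyapunov \<Sigma> V = X"
    using lyapunov_unique[OF assms(1), of X] SX by simp
  ultimately show "lyapunov \<Sigma> V = inv (lyapunov_operator \<Sigma>) V" "lyapunov \<Sigma> V \<in> Sym"
    by (simp_all add: X_def)
qed

lemma lyapunov_operator_lyapunov:
  assumes "\<Sigma> \<in> SymPD" "V \<in> Sym"
  shows "lyapunov_operator \<Sigma> (lyapunov \<Sigma> V) = V"
  unfolding lyapunov_eq_inv(1)[OF assms]
  using bij_lyapunov_operator[OF assms(1)] by (simp add: bij_is_surj surj_f_inv_f)

section \<open>The metric on positive definite matrices\<close>

lemma W_metric_eq_inner_mult:
  assumes "\<Sigma> \<in> SymPD" "U \<in> Sym" "V \<in> Sym"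
  shows "W_metric \<Sigma> U V = lyapunov \<Sigma> U \<bullet> (lyapunov \<Sigma> V ** \<Sigma>)"
  using lyapunov_eq_inv(2)[OF assms(1,3)] assms(1)
  by (simp add: W_metric_def trace_mult_eq_inner inner_matrix_mult_right Sym_def SymPD_def)

text \<open>
  The two summands of \<open>\<langle>X \<Sigma> + \<Sigma> X, Y\<rangle>\<close> agree for symmetric \<open>X\<close>, \<open>Y\<close>, \<open>\<Sigma>\<close>, because transposition exchanges
  them. In this form only one factor depends on \<open>\<Sigma>\<close>, and that linearly in the Lyapunov solution.
\<close>

lemma W_metric_eq_inner_lyapunov:
  assumes "\<Sigma> \<in> SymPD" "U \<in> Sym" "V \<in> Sym"
  shows "W_metric \<Sigma> U V = U \<bullet> lyapunov \<Sigma> V / 2"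
proof -
  define X Y where "X = lyapunov \<Sigma> U" and "Y = lyapunov \<Sigma> V"
  have sym: "transpose X = X" "transpose Y = Y" "transpose \<Sigma> = \<Sigma>"
    using lyapunov_eq_inv(2)[OF assms(1,2)] lyapunov_eq_inv(2)[OF assms(1,3)] assms(1)
    by (auto simp: X_def Y_def Sym_def SymPD_def)
  have "U \<bullet> Y = (X ** \<Sigma>) \<bullet> Y + (\<Sigma> ** X) \<bullet> Y"
    using lyapunov_operator_lyapunov[OF assms(1,2)]
    by (simp add: X_def lyapunov_operator_def inner_add_left[symmetric])
  also have "(\<Sigma> ** X) \<bullet> Y = (X ** \<Sigma>) \<bullet> Y"
    by (metis inner_transpose matrix_transpose_mul sym)
  also have "(X ** \<Sigma>) \<bullet> Y = W_metric \<Sigma> U V"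
    using W_metric_eq_inner_mult[OF assms] sym
    by (simp add: inner_matrix_mult_right X_def Y_def)
  finally show ?thesis
    by (simp add: Y_def)
qed

lemma inner_product_on_W_metric:
  fixes \<Sigma> :: "real^'n^'n"
  assumes "\<Sigma> \<in> SymPD"
  shows "inner_product_on Sym (W_metric \<Sigma>)"
  unfolding inner_product_on_def
proof (intro conjI ballI allI impI)
  fix u v w :: "real^'n^'n" and c :: real
  assume u: "u \<in> Sym" and v: "v \<in> Sym"
  show "W_metric \<Sigma> (u + v) w = W_metric \<Sigma> u w + W_metric \<Sigma> v w" if w: "w \<in> Sym"
    using u v w subspace_add[OF subspace_Sym u v]
    by (simp add: W_metric_eq_inner_lyapunov[OF assms] inner_add_left add_divide_distrib)
  show "W_metric \<Sigma> (c *\<^sub>R u) v = c * W_metric \<Sigma> u v"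
    using u v subspace_scale[OF subspace_Sym u]
    by (simp add: W_metric_eq_inner_lyapunov[OF assms])
  have "transpose (lyapunov \<Sigma> u) = lyapunov \<Sigma> u" "transpose (lyapunov \<Sigma> v) = lyapunov \<Sigma> v"
    "transpose \<Sigma> = \<Sigma>"
    using lyapunov_eq_inv(2)[OF assms u] lyapunov_eq_inv(2)[OF assms v] assms
    by (auto simp: Sym_def SymPD_def)
  then show "W_metric \<Sigma> u v = W_metric \<Sigma> v u"
    unfolding W_metric_eq_inner_mult[OF assms u v] W_metric_eq_inner_mult[OF assms v u]
    by (metis inner_commute inner_matrix_mult_right)
next
  fix u :: "real^'n^'n"
  assume u: "u \<in> Sym" and "u \<noteq> 0"
  have S: "lyapunov_operator \<Sigma> (lyapunov \<Sigma> u) = u"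
    using lyapunov_operator_lyapunov[OF assms u] .
  with \<open>u \<noteq> 0\<close> have "lyapunov \<Sigma> u \<noteq> 0"
    by (metis linear_0 linear_lyapunov_operator)
  then show "W_metric \<Sigma> u u > 0"
    using inner_lyapunov_operator_pos[OF assms] S
    by (metis W_metric_eq_inner_lyapunov[OF assms u u] inner_commute half_gt_zero)
qed

lemma smooth_on_W_metric:
  assumes "U \<in> Sym" "V \<in> Sym"
  shows "smooth_on Sym SymPD (\<lambda>\<Sigma>. W_metric \<Sigma> U V)"
  unfolding smooth_on_def
proof
  fix k
  have "Ck_on k Sym SymPD (\<lambda>\<Sigma>. inv (lyapunov_operator \<Sigma>) V)"
  proof (rule Ck_on_linear_solution[OF bounded_bilinear_lyapunov_operator _ _ _ Ck_on_const])
    fix \<Sigma> X :: "real^'n^'n"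
    assume \<Sigma>: "\<Sigma> \<in> SymPD"
    note bij = bij_lyapunov_operator[OF \<Sigma>]
    show "bounded_linear (inv (lyapunov_operator \<Sigma>))"
      using linear_lyapunov_operator bij
      by (metis bij_def linear_conv_bounded_linear linear_inj_imp_surj inj_linear_imp_inv_linear)
    show "lyapunov_operator \<Sigma> (inv (lyapunov_operator \<Sigma>) X) = X"
      using bij by (simp add: bij_is_surj surj_f_inv_f)
    show "inv (lyapunov_operator \<Sigma>) (lyapunov_operator \<Sigma> X) = X"
      using bij by (simp add: bij_is_inj)
  qed
  moreover have "bounded_linear (\<lambda>X. U \<bullet> X / 2)"
    by (intro bounded_linear_compose[OF bounded_linear_divide] bounded_linear_inner_right)
  ultimately have "Ck_on k Sym SymPD (\<lambda>\<Sigma>. U \<bullet> inv (lyapunov_operator \<Sigma>) V / 2)"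
    by (rule Ck_on_bounded_linear_compose[rotated])
  then show "Ck_on k Sym SymPD (\<lambda>\<Sigma>. W_metric \<Sigma> U V)"
    by (rule Ck_on_cong)
      (simp add: W_metric_eq_inner_lyapunov[OF _ assms] lyapunov_eq_inv(1)[OF _ assms(2)])
qed

text \<open>
  By homogeneity positive definiteness can be tested on the unit sphere. The matrices that fail this
  test form the projection of a closed set along the compact sphere, which is closed.
\<close>

lemma openin_SymPD: "openin (top_of_set Sym) (SymPD :: (real^'n^'n) set)"
proof -
  define N where "N = {A :: real^'n^'n. \<exists>x. x \<in> sphere 0 1 \<and> (x, A) \<in> {(x, A). x \<bullet> (A *v x) \<le> 0}}"
  have "closed {(x :: real^'n, A :: real^'n^'n). x \<bullet> (A *v x) \<le> 0}"
    unfolding matrix_vector_mult_def inner_vec_def case_prod_beta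
    by (intro closed_Collect_le continuous_intros)
  then have "closed N"
    unfolding N_def by (intro closed_compact_projection) auto
  moreover have "SymPD = Sym \<inter> - N"
  proof (intro set_eqI iffI)
    fix A :: "real^'n^'n"
    assume "A \<in> SymPD"
    moreover have "x \<noteq> 0" if "x \<in> sphere 0 1" for x :: "real^'n"
      using that by auto
    ultimately show "A \<in> Sym \<inter> - N"
      by (fastforce simp: SymPD_def N_def not_le[symmetric])
  next
    fix A :: "real^'n^'n"
    assume A: "A \<in> Sym \<inter> - N"
    have "x \<bullet> (A *v x) > 0" if "x \<noteq> 0" for x
    proof -
      have "sgn x \<bullet> (A *v sgn x) > 0"
        using A that by (auto simp: N_def norm_sgn not_le)
      also have "sgn x \<bullet> (A *v sgn x) = (inverse (norm x))\<^sup>2 * (x \<bullet> (A *v x))"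
        by (simp add: sgn_div_norm matrix_vector_mult_scaleR power2_eq_square)
      finally show ?thesis
        using that by (simp add: zero_less_mult_iff)
    qed
    then show "A \<in> SymPD"
      using A by (simp add: SymPD_def)
  qed
  ultimately show ?thesis
    by (auto simp: openin_open intro!: exI[of _ "- N"])
qed

lemma riemannian_metric_on_W_metric: "riemannian_metric_on Sym SymPD W_metric"
  unfolding riemannian_metric_on_def
  using subspace_Sym openin_SymPD inner_product_on_W_metric smooth_on_W_metric by blast

section \<open>The submersion\<close>

lemma open_GL: "open (GL :: (real^'n^'n) set)"
proof -
  have "continuous_on UNIV (det :: real^'n^'n \<Rightarrow> real)"
    unfolding det_def by (intro continuous_intros)
  then have "open {A :: real^'n^'n. det A \<noteq> 0}"
    by (intro open_Collect_neq continuous_intros)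
  then show ?thesis
    by (simp add: GL_def invertible_det_nz)
qed

lemma riemannian_metric_on_frobenius:
  "riemannian_metric_on UNIV (GL :: (real^'n^'n) set) (\<lambda>_. frobenius)"
  unfolding riemannian_metric_on_def inner_product_on_def smooth_on_def
  by (auto simp: frobenius_eq_inner[abs_def] open_GL inner_add_left inner_add_right
      inner_commute Ck_on_const)

lemma sigma_map_in_SymPD:
  assumes "A \<in> GL"
  shows "sigma_map A \<in> SymPD"
proof -
  have "x \<bullet> (sigma_map A *v x) > 0" if "x \<noteq> 0" for x
  proof -
    have "transpose A *v x \<noteq> 0"
      using assms that transpose_invertible[of A]
      by (simp add: GL_def del: transpose_matrix_vector)
        (metis invertible_def matrix_left_invertible_ker)
    moreover have "x \<bullet> (sigma_map A *v x) = (transpose A *v x) \<bullet> (transpose A *v x)"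
      by (metis sigma_map_def dot_lmul_matrix matrix_vector_mul_assoc transpose_matrix_vector)
    ultimately show ?thesis
      by (simp del: transpose_matrix_vector)
  qed
  then show ?thesis
    by (simp add: SymPD_def Sym_def sigma_map_def matrix_transpose_mul)
qed

definition dsigma :: "real^'n^'n \<Rightarrow> real^'n^'n \<Rightarrow> real^'n^'n" where
  "dsigma A X = X ** transpose A + A ** transpose X"

lemma bounded_bilinear_dsigma: "bounded_bilinear dsigma"
  unfolding bilinear_conv_bounded_bilinear[symmetric] bilinear_def dsigma_def
  by (auto intro!: linearI simp: matrix_mult.add_left matrix_mult.add_right transpose_add
      transpose_scalar matrix_mult.scaleR_left matrix_mult.scaleR_right scaleR_right_distrib)

lemma linear_dsigma: "linear (dsigma A)"
  using bounded_bilinear.bounded_linear_right[OF bounded_bilinear_dsigma]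
  by (rule bounded_linear.linear)

lemma sigma_map_has_derivative: "(sigma_map has_derivative dsigma A) (at A within S)"
proof -
  have "(transpose has_derivative transpose) (at A within S)"
    using linear_transpose
    by (intro bounded_linear_imp_has_derivative) (simp add: linear_conv_bounded_linear)
  then have "((\<lambda>A. A ** transpose A) has_derivative (\<lambda>X. A ** transpose X + X ** transpose A))
      (at A within S)"
    by (rule matrix_mult.FDERIV[OF has_derivative_ident])
  then show ?thesis
    by (simp add: sigma_map_def[abs_def] dsigma_def[abs_def] add.commute)
qed

lemma frechet_derivative_sigma_map: "frechet_derivative sigma_map (at A) = dsigma A"
  using frechet_derivative_at[OF sigma_map_has_derivative] by (rule sym)

text \<open>The derivative of a quadratic map is linear in the base point.\<close>

lemma smooth_on_sigma_map: "smooth_on T M sigma_map"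
  unfolding smooth_on_def
proof
  fix k
  have "Ck_on (Suc k) T M sigma_map"
    using sigma_map_has_derivative
      Ck_on_bounded_linear[OF bounded_bilinear.bounded_linear_left[OF bounded_bilinear_dsigma]]
    by (auto intro!: exI[of _ dsigma])
  then show "Ck_on k T M sigma_map"
    by (rule Ck_on_Suc_imp_Ck_on)
qed

lemma dsigma_in_Sym: "dsigma A X \<in> Sym"
  by (simp add: dsigma_def Sym_def transpose_add matrix_transpose_mul add.commute)

lemma dsigma_mult: "X \<in> Sym \<Longrightarrow> dsigma A (X ** A) = lyapunov_operator (sigma_map A) X"
  by (simp add: dsigma_def Sym_def lyapunov_operator_def sigma_map_def matrix_transpose_mul
      matrix_mul_assoc)

text \<open>
  \<open>X \<mapsto> X A\<close> is, up to the factor 2, the adjoint of the derivative \<open>D\<close>; so its values are orthogonal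
  to the kernel of \<open>D\<close>.
\<close>

lemma inner_mult_dsigma:
  assumes "X \<in> Sym"
  shows "X \<bullet> dsigma A w = 2 * ((X ** A) \<bullet> w)"
proof -
  have "X \<bullet> (A ** transpose w) = X \<bullet> (w ** transpose A)"
    using assms by (metis (mono_tags) Sym_def inner_transpose matrix_transpose_mul mem_Collect_eq
        transpose_transpose)
  then show ?thesis
    by (simp add: dsigma_def inner_add_right inner_matrix_mult_right)
qed

lemma mult_in_horizontal_space:
  assumes "X \<in> Sym"
  shows "X ** A \<in> horizontal_space (\<lambda>_. frobenius) sigma_map A"
  unfolding horizontal_space_def frechet_derivative_sigma_map frobenius_eq_inner
proof (intro CollectI allI impI)
  fix w
  assume "dsigma A w = 0"
  then show "(X ** A) \<bullet> w = 0"
    using inner_mult_dsigma[OF assms, of A w] by simp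
qed

lemma inj_on_dsigma_horizontal_space:
  "inj_on (dsigma A) (horizontal_space (\<lambda>_. frobenius) sigma_map A)"
proof (rule inj_onI)
  fix u v
  assume u: "u \<in> horizontal_space (\<lambda>_. frobenius) sigma_map A"
    and v: "v \<in> horizontal_space (\<lambda>_. frobenius) sigma_map A"
    and "dsigma A u = dsigma A v"
  then have "dsigma A (u - v) = 0"
    by (simp add: linear_diff[OF linear_dsigma])
  then have "u \<bullet> (u - v) = 0" "v \<bullet> (u - v) = 0"
    using u v
    by (simp_all add: horizontal_space_def frechet_derivative_sigma_map frobenius_eq_inner)
  then have "(u - v) \<bullet> (u - v) = 0"
    by (simp add: inner_diff_left)
  then show "u = v"
    by simp
qed

text \<open>
  The horizontal lift of \<open>V\<close> through \<open>A\<close> is \<open>L\<^sub>\<Sigma>[V] A\<close> with \<open>\<Sigma> = A A\<^sup>T\<close>; this is where the Lyapunov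
  equation enters.
\<close>

lemma dsigma_lyapunov_mult:
  assumes "A \<in> GL" "V \<in> Sym"
  shows "dsigma A (lyapunov (sigma_map A) V ** A) = V"
  using assms
  by (simp add: dsigma_mult lyapunov_eq_inv(2) lyapunov_operator_lyapunov sigma_map_in_SymPD)

lemma horizontal_eq_mult:
  assumes "A \<in> GL" and u: "u \<in> horizontal_space (\<lambda>_. frobenius) sigma_map A"
  shows "u = lyapunov (sigma_map A) (dsigma A u) ** A"
proof (rule inj_onD[OF inj_on_dsigma_horizontal_space _ u mult_in_horizontal_space])
  show "lyapunov (sigma_map A) (dsigma A u) \<in> Sym"
    using assms(1) by (intro lyapunov_eq_inv(2) sigma_map_in_SymPD dsigma_in_Sym)
  show "dsigma A u = dsigma A (lyapunov (sigma_map A) (dsigma A u) ** A)"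
    using assms(1) by (simp add: dsigma_lyapunov_mult dsigma_in_Sym)
qed

lemma bij_betw_dsigma_horizontal_space:
  assumes "A \<in> GL"
  shows "bij_betw (dsigma A) (horizontal_space (\<lambda>_. frobenius) sigma_map A) Sym"
proof (rule bij_betw_imageI[OF inj_on_dsigma_horizontal_space])
  have "V \<in> dsigma A ` horizontal_space (\<lambda>_. frobenius) sigma_map A" if "V \<in> Sym" for V
    using assms that mult_in_horizontal_space[of "lyapunov (sigma_map A) V" A]
    by (metis dsigma_lyapunov_mult imageI lyapunov_eq_inv(2) sigma_map_in_SymPD)
  then show "dsigma A ` horizontal_space (\<lambda>_. frobenius) sigma_map A = Sym"
    using dsigma_in_Sym by blast
qed

lemma W_metric_dsigma:
  assumes A: "A \<in> GL"
    and u: "u \<in> horizontal_space (\<lambda>_. frobenius) sigma_map A"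
    and v: "v \<in> horizontal_space (\<lambda>_. frobenius) sigma_map A"
  shows "W_metric (sigma_map A) (dsigma A u) (dsigma A v) = frobenius u v"
proof -
  define X Y where "X = lyapunov (sigma_map A) (dsigma A u)"
    and "Y = lyapunov (sigma_map A) (dsigma A v)"
  have "W_metric (sigma_map A) (dsigma A u) (dsigma A v) = X \<bullet> (Y ** (A ** transpose A))"
    using W_metric_eq_inner_mult[OF sigma_map_in_SymPD[OF A] dsigma_in_Sym dsigma_in_Sym]
    by (simp add: X_def Y_def sigma_map_def)
  also have "\<dots> = (X ** A) \<bullet> (Y ** A)"
    by (simp add: inner_matrix_mult_right matrix_mul_assoc)
  also have "\<dots> = frobenius u v"
    by (simp add: X_def Y_def frobenius_eq_inner horizontal_eq_mult[OF A u, symmetric]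
        horizontal_eq_mult[OF A v, symmetric])
  finally show ?thesis .
qed

theorem proposition6:
  shows "riemannian_metric_on (Sym :: (real^'n^'n) set) SymPD W_metric \<and>
         riemannian_submersion (GL :: (real^'n^'n) set) (\<lambda>_. frobenius) Sym SymPD W_metric sigma_map"
proof -
  have "range (dsigma A) = Sym" if "A \<in> GL" for A :: "real^'n^'n"
    using dsigma_in_Sym dsigma_lyapunov_mult[OF that] by (auto simp: image_iff) metis
  then show ?thesis
    unfolding riemannian_submersion_def frechet_derivative_sigma_map
    using riemannian_metric_on_W_metric riemannian_metric_on_frobenius smooth_on_sigma_map
      bij_betw_dsigma_horizontal_space sigma_map_in_SymPD W_metric_dsigma by blast
qed

end
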